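(* Let $A(x)$, $x\in M$, be an operator family on the compact $m$-dimensional manifold $M$ consisting of local Fredholm operators and continuous, with respect to $|||\cdot|||$, on each component $\overline{M_k\setminus\bigcup_{i=0}^{k-1}M_i}$, $k=0,1,\dots,m$, and let $A:\bigoplus_{k=0}^mH^{(1)}_k\to\bigoplus_{k=0}^mH^{(2)}_k$ be the Fredholm operator generated by this family, with components $A^{(k)}:H^{(1)}_k\to H^{(2)}_k$. Then the index of $A$ is the sum of the corresponding indices: $$\operatorname{Ind}A=\sum_{k=0}^m\operatorname{Ind}A^{(k)} .$$
   Context: The index of an operator $A$ is $\operatorname{Ind}A=\dim\operatorname{Ker}A-\dim\operatorname{Coker}A$. Spaces and operators. All function spaces are Banach spaces of functions that contain the smooth functions with compact support as a dense subset and on which multiplication by a smooth function is a bounded operator; the same letter $f$ denotes a smooth function and the operator of multiplication by it, so $(f\cdot A\cdot g)u=fA(gu)$. All operators are considered up to compact operators. For a bounded operator $A:B_1\to B_2$ between Banach spaces, $|||A|||=\inf\|A+T\|$, the infimum being taken over all compact $T:B_1\to B_2$. An operator $A$ is called local if $f\cdot A\cdot g$ is compact for all smooth functions $f,g$ with non-intersecting supports. Operator family. $M$ is a compact $m$-dimensional manifold with boundary $\partial M$; $M_0,\dots,M_{m-1}=\partial M$ are smooth sub-manifolds of $\partial M$ with $\dim M_k=k$ ($M_0$ consists of isolated points), and $M_m=M$. $H^{(j)}_k$, $k=0,\dots,m$, $j=1,2$, are Banach spaces of functions that contain the smooth functions with compact support as a dense subset and on which multiplication by a smooth function is a bounded operator,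 and $\mathrm{T}_k$ is a class of bounded linear operators $H^{(1)}_k\to H^{(2)}_k$. One has $A(x)\in\mathrm{T}_k$ for $x\in M_k$, with the convention that at a point $x\in M_r\cap M_{k-1}$ with $r\ge k$ one has $A(x)\in\mathrm{T}_{k-1}$. Generated operator. For $k=0,\dots,m$ one successively chooses finite coverings $\mathcal U_k$ of $M_k\setminus(\mathcal U_0\cup\dots\cup\mathcal U_{k-1})$ (where $\mathcal U_i$ also denotes the union of the elements of the covering) by small balls $U^{(k)}_j$ centered at points $x^{(k)}_j\in M_k$, $j=1,\dots,n_k$, a partition of unity $\{f^{(k)}_j\}$ subordinate to $\mathcal U_k$, and smooth functions $g^{(k)}_j$ supported in a neighborhood of $\overline{U^{(k)}_j}$ with $g^{(k)}_j\equiv1$ on $\operatorname{supp} f^{(k)}_j$ and $\operatorname{supp} f^{(k)}_j\cap\operatorname{supp}(1-g^{(k)}_j)=\emptyset$. Given a sequence $\varepsilon_n>0$, $\varepsilon_n\to0$, the coverings are chosen so that $|||f^{(k)}_j\cdot(A(x)-A(x^{(k)}_j))\cdot g^{(k)}_j|||<\varepsilon_{n_k}$ for all $x\in U^{(k)}_j$. Put $A_{n_k}=\sum_{j=1}^{n_k}f^{(k)}_j\cdot A(x^{(k)}_j)\cdot g^{(k)}_j:H^{(1)}_k\to H^{(2)}_k$. The operator $A^{(k)}$ is the limit of $A_{n_k}$ with respect to $|||\cdot|||$, and the generated operator is $A=\bigoplus_{k=0}^mA^{(k)}$, i.e. $Au=\bigoplus_{k=0}^mA^{(k)}u_k$ for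 $u=\bigoplus_{k=0}^mu_k$. Under the stated hypotheses this operator exists, is Fredholm and is unique up to compact operators. *)

theory Defs
  imports "HOL-Analysis.Analysis" "HOL-Library.Function_Algebras"
begin

section \<open>Smooth manifolds with boundary\<close>

primrec times_differentiable_on ::
    "nat \<Rightarrow> 'e::euclidean_space set \<Rightarrow> ('e \<Rightarrow> 'b::real_normed_vector) \<Rightarrow> bool" where
  "times_differentiable_on 0 S f \<longleftrightarrow> continuous_on S f"
| "times_differentiable_on (Suc n) S f \<longleftrightarrow>
     (\<forall>x\<in>S. f differentiable (at x)) \<and>
     (\<forall>v. times_differentiable_on n S (\<lambda>x. frechet_derivative f (at x) v))"

text \<open>On a set that is not open (a relatively open part of a half-space), smoothness means that
  the function locally extends to a smooth function on an open set.\<close>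

definition smooth_on :: "'e::euclidean_space set \<Rightarrow> ('e \<Rightarrow> 'b::real_normed_vector) \<Rightarrow> bool" where
  "smooth_on S f \<longleftrightarrow>
     (\<forall>x\<in>S. \<exists>W F. open W \<and> x \<in> W \<and> (\<forall>n. times_differentiable_on n W F) \<and>
        (\<forall>y\<in>S \<inter> W. F y = f y))"

definition half_space :: "'e::euclidean_space set" where
  "half_space = {v. 0 \<le> v \<bullet> (SOME b. b \<in> Basis)}"

definition wall :: "'e::euclidean_space set" where
  "wall = {v. v \<bullet> (SOME b. b \<in> Basis) = 0}"

text \<open>The dimension of a manifold is the dimension \<open>DIM('e)\<close> of the space its charts map to.\<close>

type_synonym ('x, 'e) chart = "'x set \<times> ('x \<Rightarrow> 'e)"

definition is_chart :: "'x::metric_space set \<Rightarrow> ('x, 'e::euclidean_space) chart \<Rightarrow> bool" where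
  "is_chart M c \<longleftrightarrow> (case c of (U, \<phi>) \<Rightarrow>
     openin (top_of_set M) U \<and> openin (top_of_set half_space) (\<phi> ` U) \<and>
     (\<exists>\<psi>. homeomorphism U (\<phi> ` U) \<phi> \<psi>))"

definition compatible_charts :: "('x, 'e::euclidean_space) chart \<Rightarrow> ('x, 'e) chart \<Rightarrow> bool" where
  "compatible_charts c d \<longleftrightarrow> (case c of (U, \<phi>) \<Rightarrow> case d of (V, \<psi>) \<Rightarrow>
     smooth_on (\<phi> ` (U \<inter> V)) (\<psi> \<circ> inv_into U \<phi>) \<and>
     smooth_on (\<psi> ` (U \<inter> V)) (\<phi> \<circ> inv_into V \<psi>))"

definition smooth_manifold ::
    "'x::metric_space set \<Rightarrow> ('x, 'e::euclidean_space) chart set \<Rightarrow> bool" where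
  "smooth_manifold M \<A> \<longleftrightarrow>
     (\<forall>c\<in>\<A>. is_chart M c) \<and> (\<Union>c\<in>\<A>. fst c) = M \<and>
     (\<forall>c\<in>\<A>. \<forall>d\<in>\<A>. compatible_charts c d)"

definition manifold_boundary ::
    "'x::metric_space set \<Rightarrow> ('x, 'e::euclidean_space) chart set \<Rightarrow> 'x set" where
  "manifold_boundary M \<A> = {x \<in> M. \<exists>(U, \<phi>)\<in>\<A>. x \<in> U \<and> \<phi> x \<in> wall}"

text \<open>Embedded \<open>k\<close>-dimensional submanifolds of the boundary, given by slice charts; the slice charts
  belong to the maximal atlas.\<close>

definition boundary_submanifold ::
    "'x::metric_space set \<Rightarrow> ('x, 'e::euclidean_space) chart set \<Rightarrow> nat \<Rightarrow> 'x set \<Rightarrow> bool" where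
  "boundary_submanifold M \<A> k N \<longleftrightarrow>
     N \<subseteq> manifold_boundary M \<A> \<and>
     (\<forall>p\<in>N. \<exists>U \<phi> L. is_chart M (U, \<phi>) \<and> (\<forall>c\<in>\<A>. compatible_charts c (U, \<phi>)) \<and> p \<in> U \<and>
        affine L \<and> aff_dim L = int k \<and> L \<subseteq> wall \<and> \<phi> ` (U \<inter> N) = \<phi> ` U \<inter> L)"

definition stratified_manifold ::
    "'x::metric_space set \<Rightarrow> ('x, 'e::euclidean_space) chart set \<Rightarrow> nat \<Rightarrow> (nat \<Rightarrow> 'x set) \<Rightarrow> bool"
  where
  "stratified_manifold M \<A> m Ms \<longleftrightarrow>
     smooth_manifold M \<A> \<and> m = DIM('e) \<and>
     (\<forall>k<m. boundary_submanifold M \<A> k (Ms k)) \<and>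
     Ms (m - 1) = manifold_boundary M \<A> \<and> Ms m = M"

definition stratum :: "(nat \<Rightarrow> 'x set) \<Rightarrow> nat \<Rightarrow> 'x set" where
  "stratum Ms k = Ms k - (\<Union>i<k. Ms i)"

definition smooth_functions ::
    "('x, 'e::euclidean_space) chart set \<Rightarrow> ('x \<Rightarrow> 'k::real_normed_vector) set" where
  "smooth_functions \<A> = {f. \<forall>(U, \<phi>)\<in>\<A>. smooth_on (\<phi> ` U) (f \<circ> inv_into U \<phi>)}"

definition supp :: "'x::metric_space set \<Rightarrow> ('x \<Rightarrow> 'k::zero) \<Rightarrow> 'x set" where
  "supp M f = M \<inter> closure {x \<in> M. f x \<noteq> 0}"

definition test_functions ::
    "'x::metric_space set \<Rightarrow> ('x, 'e::euclidean_space) chart set \<Rightarrow>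
      ('x \<Rightarrow> 'k::real_normed_vector) set" where
  "test_functions M \<A> = {f \<in> smooth_functions \<A>. compact (supp M f)}"


section \<open>Banach spaces and operators\<close>

text \<open>Since the spaces are indexed by \<open>k\<close>, a normed space is a subspace of an ambient vector space
  \<open>'v\<close> together with its own norm. Operators are functions on \<open>'v\<close> of which only the values on
  the domain space matter. The scalar type \<open>'k\<close> (a complete real normed field) covers both the
  real and the complex numbers; \<open>s\<close> is scalar multiplication on \<open>'v\<close>.\<close>

record 'v normed_space =
  pts :: "'v set"
  nrm :: "'v \<Rightarrow> real"

definition ndist :: "'v::ab_group_add normed_space \<Rightarrow> 'v \<Rightarrow> 'v \<Rightarrow> real" where
  "ndist H u v = nrm H (u - v)"

definition ntop :: "'v::ab_group_add normed_space \<Rightarrow> 'v topology" where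
  "ntop H = Metric_space.mtopology (pts H) (ndist H)"

definition banach_space ::
    "('k::{real_normed_field,banach} \<Rightarrow> 'v::ab_group_add \<Rightarrow> 'v) \<Rightarrow> 'v normed_space \<Rightarrow> bool" where
  "banach_space s H \<longleftrightarrow>
     module.subspace s (pts H) \<and>
     (\<forall>u\<in>pts H. 0 \<le> nrm H u \<and> (nrm H u = 0 \<longleftrightarrow> u = 0)) \<and>
     (\<forall>u\<in>pts H. \<forall>v\<in>pts H. nrm H (u + v) \<le> nrm H u + nrm H v) \<and>
     (\<forall>c. \<forall>u\<in>pts H. nrm H (s c u) = norm c * nrm H u) \<and>
     Metric_space.mcomplete (pts H) (ndist H)"

definition bounded_operator ::
    "('k \<Rightarrow> 'v::ab_group_add \<Rightarrow> 'v) \<Rightarrow> 'v normed_space \<Rightarrow> 'v normed_space \<Rightarrow> ('v \<Rightarrow> 'v) \<Rightarrow> bool" where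
  "bounded_operator s H1 H2 A \<longleftrightarrow>
     A ` pts H1 \<subseteq> pts H2 \<and>
     (\<forall>u\<in>pts H1. \<forall>v\<in>pts H1. A (u + v) = A u + A v) \<and>
     (\<forall>c. \<forall>u\<in>pts H1. A (s c u) = s c (A u)) \<and>
     (\<exists>C. \<forall>u\<in>pts H1. nrm H2 (A u) \<le> C * nrm H1 u)"

definition compact_operator ::
    "('k \<Rightarrow> 'v::ab_group_add \<Rightarrow> 'v) \<Rightarrow> 'v normed_space \<Rightarrow> 'v normed_space \<Rightarrow> ('v \<Rightarrow> 'v) \<Rightarrow> bool" where
  "compact_operator s H1 H2 T \<longleftrightarrow>
     bounded_operator s H1 H2 T \<and>
     compactin (ntop H2) (ntop H2 closure_of (T ` {u \<in> pts H1. nrm H1 u \<le> 1}))"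

definition op_norm ::
    "'v::ab_group_add normed_space \<Rightarrow> 'v normed_space \<Rightarrow> ('v \<Rightarrow> 'v) \<Rightarrow> real" where
  "op_norm H1 H2 A = (SUP u\<in>{u \<in> pts H1. nrm H1 u \<le> 1}. nrm H2 (A u))"

definition ess_norm ::
    "('k \<Rightarrow> 'v::ab_group_add \<Rightarrow> 'v) \<Rightarrow> 'v normed_space \<Rightarrow> 'v normed_space \<Rightarrow> ('v \<Rightarrow> 'v) \<Rightarrow> real" where
  "ess_norm s H1 H2 A =
     (INF T\<in>{T. compact_operator s H1 H2 T}. op_norm H1 H2 (\<lambda>u. A u + T u))"


section \<open>Fredholm operators and the index\<close>

definition ker_on :: "'v::ab_group_add normed_space \<Rightarrow> ('v \<Rightarrow> 'v) \<Rightarrow> 'v set" where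
  "ker_on H A = {u \<in> pts H. A u = 0}"

definition finite_dimensional ::
    "('k::field \<Rightarrow> 'v::ab_group_add \<Rightarrow> 'v) \<Rightarrow> 'v set \<Rightarrow> bool" where
  "finite_dimensional s V \<longleftrightarrow> (\<exists>B. finite B \<and> V \<subseteq> module.span s B)"

text \<open>The quotient \<open>V / W\<close> as a set of cosets. The classes of \<open>B \<subseteq> V\<close> form a basis of it if every
  coset is a linear combination of them in exactly one way; linear combinations of cosets are
  computed on representatives.\<close>

definition coset :: "'v::ab_group_add set \<Rightarrow> 'v \<Rightarrow> 'v set" where
  "coset W y = (\<lambda>w. y + w) ` W"

definition quotient_space :: "'v::ab_group_add set \<Rightarrow> 'v set \<Rightarrow> 'v set set" where
  "quotient_space V W = coset W ` V"

definition quotient_basis ::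
    "('k::field \<Rightarrow> 'v::ab_group_add \<Rightarrow> 'v) \<Rightarrow> 'v set \<Rightarrow> 'v set \<Rightarrow> 'v set \<Rightarrow> bool" where
  "quotient_basis s V W B \<longleftrightarrow>
     finite B \<and> B \<subseteq> V \<and>
     (\<forall>X\<in>quotient_space V W. \<exists>!c. c \<in> B \<rightarrow>\<^sub>E UNIV \<and> X = coset W (\<Sum>b\<in>B. s (c b) b))"

definition quotient_dim ::
    "('k::field \<Rightarrow> 'v::ab_group_add \<Rightarrow> 'v) \<Rightarrow> 'v set \<Rightarrow> 'v set \<Rightarrow> nat" where
  "quotient_dim s V W = (THE n. \<exists>B. quotient_basis s V W B \<and> card B = n)"

definition fredholm ::
    "('k::field \<Rightarrow> 'v::ab_group_add \<Rightarrow> 'v) \<Rightarrow> 'v normed_space \<Rightarrow> 'v normed_space \<Rightarrow> ('v \<Rightarrow> 'v) \<Rightarrow> bool"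
  where
  "fredholm s H1 H2 A \<longleftrightarrow>
     bounded_operator s H1 H2 A \<and> finite_dimensional s (ker_on H1 A) \<and>
     (\<exists>B. quotient_basis s (pts H2) (A ` pts H1) B)"

definition fredholm_index ::
    "('k::field \<Rightarrow> 'v::ab_group_add \<Rightarrow> 'v) \<Rightarrow> 'v normed_space \<Rightarrow> 'v normed_space \<Rightarrow> ('v \<Rightarrow> 'v) \<Rightarrow> int"
  where
  "fredholm_index s H1 H2 A =
     int (vector_space.dim s (ker_on H1 A)) - int (quotient_dim s (pts H2) (A ` pts H1))"


section \<open>Direct sums\<close>

text \<open>Elements of a direct sum over \<open>k \<le> m\<close> are sequences in \<open>'v\<close> that vanish beyond \<open>m\<close>.\<close>

definition direct_sum :: "nat \<Rightarrow> (nat \<Rightarrow> 'v::ab_group_add normed_space) \<Rightarrow> (nat \<Rightarrow> 'v) normed_space"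
  where
  "direct_sum m H =
     \<lparr>pts = {u. (\<forall>k\<le>m. u k \<in> pts (H k)) \<and> (\<forall>k>m. u k = 0)},
      nrm = (\<lambda>u. \<Sum>k\<le>m. nrm (H k) (u k))\<rparr>"

definition direct_sum_scale :: "('k \<Rightarrow> 'v \<Rightarrow> 'v) \<Rightarrow> 'k \<Rightarrow> (nat \<Rightarrow> 'v) \<Rightarrow> nat \<Rightarrow> 'v" where
  "direct_sum_scale s c u = (\<lambda>k. s c (u k))"

definition direct_sum_operator ::
    "nat \<Rightarrow> (nat \<Rightarrow> 'v \<Rightarrow> 'v::zero) \<Rightarrow> (nat \<Rightarrow> 'v) \<Rightarrow> nat \<Rightarrow> 'v" where
  "direct_sum_operator m Ak u = (\<lambda>k. if k \<le> m then Ak k (u k) else 0)"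


section \<open>Spaces of functions on a manifold\<close>

text \<open>The Banach spaces of functions (Lebesgue, Sobolev spaces, ...) need not consist of pointwise
  defined functions. Their elements are taken from an ambient vector space of generalized
  functions on \<open>M\<close>: \<open>emb\<close> embeds the smooth functions with compact support (functions that agree
  on \<open>M\<close> being identified), and \<open>mul f\<close> is multiplication by the smooth function \<open>f\<close>.\<close>

locale generalized_functions = vector_space s
  for s :: "'k::{real_normed_field,banach} \<Rightarrow> 'v::ab_group_add \<Rightarrow> 'v" +
  fixes M :: "'x::metric_space set"
    and \<A> :: "('x, 'e::euclidean_space) chart set"
    and emb :: "('x \<Rightarrow> 'k) \<Rightarrow> 'v"
    and mul :: "('x \<Rightarrow> 'k) \<Rightarrow> 'v \<Rightarrow> 'v"
  assumes emb_eq_iff: "\<lbrakk>\<phi> \<in> test_functions M \<A>; \<psi> \<in> test_functions M \<A>\<rbrakk> \<Longrightarrow>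
        emb \<phi> = emb \<psi> \<longleftrightarrow> (\<forall>x\<in>M. \<phi> x = \<psi> x)"
    and emb_add: "\<lbrakk>\<phi> \<in> test_functions M \<A>; \<psi> \<in> test_functions M \<A>\<rbrakk> \<Longrightarrow>
        emb (\<lambda>x. \<phi> x + \<psi> x) = emb \<phi> + emb \<psi>"
    and emb_scale: "\<phi> \<in> test_functions M \<A> \<Longrightarrow> emb (\<lambda>x. c * \<phi> x) = s c (emb \<phi>)"
    and mul_emb: "\<lbrakk>f \<in> smooth_functions \<A>; \<phi> \<in> test_functions M \<A>\<rbrakk> \<Longrightarrow>
        mul f (emb \<phi>) = emb (\<lambda>x. f x * \<phi> x)"
    and mul_cong: "\<lbrakk>f \<in> smooth_functions \<A>; g \<in> smooth_functions \<A>; \<forall>x\<in>M. f x = g x\<rbrakk> \<Longrightarrow>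
        mul f u = mul g u"
    and mul_add_right: "f \<in> smooth_functions \<A> \<Longrightarrow> mul f (u + v) = mul f u + mul f v"
    and mul_add_left: "\<lbrakk>f \<in> smooth_functions \<A>; g \<in> smooth_functions \<A>\<rbrakk> \<Longrightarrow>
        mul (\<lambda>x. f x + g x) u = mul f u + mul g u"
    and mul_mul: "\<lbrakk>f \<in> smooth_functions \<A>; g \<in> smooth_functions \<A>\<rbrakk> \<Longrightarrow>
        mul (\<lambda>x. f x * g x) u = mul f (mul g u)"
    and mul_const: "mul (\<lambda>x. c) u = s c u"

definition banach_function_space ::
    "('k::{real_normed_field,banach} \<Rightarrow> 'v::ab_group_add \<Rightarrow> 'v) \<Rightarrow> 'x::metric_space set \<Rightarrow>
      ('x, 'e::euclidean_space) chart set \<Rightarrow> (('x \<Rightarrow> 'k) \<Rightarrow> 'v) \<Rightarrow> (('x \<Rightarrow> 'k) \<Rightarrow> 'v \<Rightarrow> 'v) \<Rightarrow>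
      'v normed_space \<Rightarrow> bool" where
  "banach_function_space s M \<A> emb mul H \<longleftrightarrow>
     banach_space s H \<and>
     emb ` test_functions M \<A> \<subseteq> pts H \<and>
     ntop H closure_of (emb ` test_functions M \<A>) = pts H \<and>
     (\<forall>f\<in>smooth_functions \<A>. bounded_operator s H H (mul f))"

definition sandwich ::
    "(('x \<Rightarrow> 'k) \<Rightarrow> 'v \<Rightarrow> 'v) \<Rightarrow> ('x \<Rightarrow> 'k) \<Rightarrow> ('v \<Rightarrow> 'v) \<Rightarrow> ('x \<Rightarrow> 'k) \<Rightarrow> 'v \<Rightarrow> 'v" where
  "sandwich mul f A g = (\<lambda>u. mul f (A (mul g u)))"

definition local_operator ::
    "('k::{real_normed_field,banach} \<Rightarrow> 'v::ab_group_add \<Rightarrow> 'v) \<Rightarrow> 'x::metric_space set \<Rightarrow>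
      ('x, 'e::euclidean_space) chart set \<Rightarrow> (('x \<Rightarrow> 'k) \<Rightarrow> 'v \<Rightarrow> 'v) \<Rightarrow>
      'v normed_space \<Rightarrow> 'v normed_space \<Rightarrow> ('v \<Rightarrow> 'v) \<Rightarrow> bool" where
  "local_operator s M \<A> mul H1 H2 A \<longleftrightarrow>
     (\<forall>f\<in>smooth_functions \<A>. \<forall>g\<in>smooth_functions \<A>.
        supp M f \<inter> supp M g = {} \<longrightarrow> compact_operator s H1 H2 (sandwich mul f A g))"


section \<open>Operator families and the operators they generate\<close>

text \<open>\<open>A x\<close> acts between the spaces of level \<open>k\<close>, where \<open>k\<close> is the least index with \<open>x \<in> Ms k\<close>,
  i.e. \<open>x \<in> stratum Ms k\<close>.\<close>

definition operator_family ::
    "('k::{real_normed_field,banach} \<Rightarrow> 'v::ab_group_add \<Rightarrow> 'v) \<Rightarrow> nat \<Rightarrow> (nat \<Rightarrow> 'x set) \<Rightarrow>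
      (nat \<Rightarrow> 'v normed_space) \<Rightarrow> (nat \<Rightarrow> 'v normed_space) \<Rightarrow> (nat \<Rightarrow> ('v \<Rightarrow> 'v) set) \<Rightarrow>
      ('x \<Rightarrow> 'v \<Rightarrow> 'v) \<Rightarrow> bool" where
  "operator_family s m Ms H1 H2 T A \<longleftrightarrow>
     (\<forall>k\<le>m. \<forall>B\<in>T k. bounded_operator s (H1 k) (H2 k) B) \<and>
     (\<forall>k\<le>m. \<forall>x\<in>stratum Ms k. A x \<in> T k)"

text \<open>A point of \<open>closure (stratum Ms k)\<close> may lie in a stratum of lower index, where \<open>A x\<close> acts
  between other spaces. Continuity on the closure therefore means that the family on
  \<open>stratum Ms k\<close> extends continuously to the closure.\<close>

definition continuous_family_on_closure ::
    "('k::{real_normed_field,banach} \<Rightarrow> 'v::ab_group_add \<Rightarrow> 'v) \<Rightarrow> 'v normed_space \<Rightarrow>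
      'v normed_space \<Rightarrow> 'x::metric_space set \<Rightarrow> ('x \<Rightarrow> 'v \<Rightarrow> 'v) \<Rightarrow> bool" where
  "continuous_family_on_closure s H1 H2 S A \<longleftrightarrow>
     (\<exists>E. (\<forall>x\<in>S. E x = A x) \<and>
        (\<forall>x\<in>closure S. bounded_operator s H1 H2 (E x)) \<and>
        (\<forall>x\<in>closure S. \<forall>e>0. \<exists>d>0. \<forall>y\<in>closure S.
           dist y x < d \<longrightarrow> ess_norm s H1 H2 (\<lambda>u. E y u - E x u) < e))"

record ('x, 'k) cover =
  num :: nat
  centre :: "nat \<Rightarrow> 'x"
  radius :: "nat \<Rightarrow> real"
  weight :: "nat \<Rightarrow> 'x \<Rightarrow> 'k"
  cutoff :: "nat \<Rightarrow> 'x \<Rightarrow> 'k"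

definition cover_ball :: "'x::metric_space set \<Rightarrow> ('x, 'k) cover \<Rightarrow> nat \<Rightarrow> 'x set" where
  "cover_ball M c j = M \<inter> ball (centre c j) (radius c j)"

definition cover_union :: "'x::metric_space set \<Rightarrow> ('x, 'k) cover \<Rightarrow> 'x set" where
  "cover_union M c = (\<Union>j\<in>{1..num c}. cover_ball M c j)"

text \<open>\<open>K\<close> is the set to be covered and \<open>S\<close> the stratum that carries the operators \<open>A x\<close> from
  \<open>H1\<close> to \<open>H2\<close>. How small the balls are is controlled by the oscillation bound \<open>\<epsilon>\<close>.\<close>

definition adapted_cover ::
    "('k::{real_normed_field,banach} \<Rightarrow> 'v::ab_group_add \<Rightarrow> 'v) \<Rightarrow> 'x::metric_space set \<Rightarrow>
      ('x, 'e::euclidean_space) chart set \<Rightarrow> (('x \<Rightarrow> 'k) \<Rightarrow> 'v \<Rightarrow> 'v) \<Rightarrow>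
      'v normed_space \<Rightarrow> 'v normed_space \<Rightarrow> 'x set \<Rightarrow> 'x set \<Rightarrow> ('x \<Rightarrow> 'v \<Rightarrow> 'v) \<Rightarrow> real \<Rightarrow>
      ('x, 'k) cover \<Rightarrow> bool" where
  "adapted_cover s M \<A> mul H1 H2 K S A \<epsilon> c \<longleftrightarrow>
     K \<subseteq> cover_union M c \<and>
     (\<forall>x\<in>K. (\<Sum>j=1..num c. weight c j x) = 1) \<and>
     (\<forall>j\<in>{1..num c}.
        centre c j \<in> S \<and> 0 < radius c j \<and>
        weight c j \<in> smooth_functions \<A> \<and> cutoff c j \<in> smooth_functions \<A> \<and>
        (\<forall>x\<in>M. weight c j x \<in> of_real ` {0..1}) \<and>
        supp M (weight c j) \<subseteq> cover_ball M c j \<and>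
        (\<exists>V. openin (top_of_set M) V \<and> M \<inter> closure (cover_ball M c j) \<subseteq> V \<and>
           supp M (cutoff c j) \<subseteq> V) \<and>
        (\<forall>x\<in>supp M (weight c j). cutoff c j x = 1) \<and>
        supp M (weight c j) \<inter> supp M (\<lambda>x. 1 - cutoff c j x) = {} \<and>
        (\<forall>x\<in>cover_ball M c j \<inter> S.
           ess_norm s H1 H2
             (sandwich mul (weight c j) (\<lambda>u. A x u - A (centre c j) u) (cutoff c j)) < \<epsilon>))"

definition cover_operator ::
    "(('x \<Rightarrow> 'k) \<Rightarrow> 'v \<Rightarrow> 'v::ab_group_add) \<Rightarrow> ('x \<Rightarrow> 'v \<Rightarrow> 'v) \<Rightarrow> ('x, 'k) cover \<Rightarrow> 'v \<Rightarrow> 'v" where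
  "cover_operator mul A c u =
     (\<Sum>j=1..num c. sandwich mul (weight c j) (A (centre c j)) (cutoff c j) u)"

text \<open>\<open>cov n k\<close> is the covering at level \<open>k\<close> in the \<open>n\<close>-th approximation step; it covers what
  the coverings at the lower levels of the same step leave over of \<open>Ms k\<close>.\<close>

definition generated_components ::
    "('k::{real_normed_field,banach} \<Rightarrow> 'v::ab_group_add \<Rightarrow> 'v) \<Rightarrow> 'x::metric_space set \<Rightarrow>
      ('x, 'e::euclidean_space) chart set \<Rightarrow> (('x \<Rightarrow> 'k) \<Rightarrow> 'v \<Rightarrow> 'v) \<Rightarrow> nat \<Rightarrow> (nat \<Rightarrow> 'x set) \<Rightarrow>
      (nat \<Rightarrow> 'v normed_space) \<Rightarrow> (nat \<Rightarrow> 'v normed_space) \<Rightarrow> ('x \<Rightarrow> 'v \<Rightarrow> 'v) \<Rightarrow>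
      (nat \<Rightarrow> 'v \<Rightarrow> 'v) \<Rightarrow> bool" where
  "generated_components s M \<A> mul m Ms H1 H2 A Ak \<longleftrightarrow>
     (\<exists>(\<epsilon> :: nat \<Rightarrow> real) (cov :: nat \<Rightarrow> nat \<Rightarrow> ('x, 'k) cover).
        (\<forall>n. 0 < \<epsilon> n) \<and> \<epsilon> \<longlonglongrightarrow> 0 \<and>
        (\<forall>n. \<forall>k\<le>m. adapted_cover s M \<A> mul (H1 k) (H2 k)
            (Ms k - (\<Union>i<k. cover_union M (cov n i))) (stratum Ms k) A (\<epsilon> n) (cov n k)) \<and>
        (\<forall>k\<le>m. bounded_operator s (H1 k) (H2 k) (Ak k) \<and>
           (\<lambda>n. ess_norm s (H1 k) (H2 k) (\<lambda>u. cover_operator mul A (cov n k) u - Ak k u))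
             \<longlonglongrightarrow> 0))"

end

theory Submission
  imports Defs
begin

text \<open>The generated operator acts diagonally, so its kernel and its image are the direct sums of
  the kernels and the images of its components. The theorem is therefore the additivity of
  dimensions under direct sums, applied once to kernels and once to cokernels.

  Both applications are instances of one statement about quotients: if the quotient of
  \<open>\<Oplus>V\<^sub>k\<close> by \<open>\<Oplus>W\<^sub>k\<close> is finite dimensional, then so is each \<open>V\<^sub>k / W\<^sub>k\<close>, and the dimensions
  add up (\<open>quotient_dim_direct_sum\<close>). A kernel is the quotient by the zero space. Finiteness
  passes to the components because projecting a finite system that generates the whole quotient
  gives a finite system that generates the component, and such a system contains a basis. The
  dimensions add up because the bases of the components, placed in their respective positions,
  form a basis of the whole. Finally, the dimension of a quotient may be computed from any basis:
  representatives of linearly independent classes can be moved into the span of representatives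
  of generating classes without losing independence, and so the usual exchange bound applies.

  The Fredholm property of the generated operator supplies the finiteness; linearity of the
  components makes their kernels and images subspaces.\<close>

section \<open>Bases of quotient spaces\<close>

context vector_space
begin

lemma coset_eq_iff:
  assumes W: "subspace W"
  shows "coset W x = coset W y \<longleftrightarrow> x - y \<in> W"
proof
  assume "coset W x = coset W y"
  moreover have "x \<in> coset W x"
    using subspace_0[OF W] by (force simp: coset_def)
  ultimately show "x - y \<in> W" by (auto simp: coset_def)
next
  assume xy: "x - y \<in> W"
  have "\<exists>w'\<in>W. x + w = y + w'" if "w \<in> W" for w
    using subspace_add[OF W xy that] by (intro bexI[of _ "x - y + w"]) auto
  moreover have "\<exists>w'\<in>W. y + w = x + w'" if "w \<in> W" for w
    using subspace_diff[OF W that xy] by (intro bexI[of _ "w - (x - y)"]) auto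
  ultimately show "coset W x = coset W y"
    unfolding coset_def by (fastforce simp: image_iff)
qed

text \<open>Unique representability of all cosets amounts to generation and independence modulo \<open>W\<close>;
  the latter is the form in which quotient bases are used below.\<close>

lemma quotient_basis_iff:
  assumes V: "subspace V" and W: "subspace W"
  shows "quotient_basis scale V W B \<longleftrightarrow>
    finite B \<and> B \<subseteq> V \<and>
    (\<forall>v\<in>V. \<exists>x\<in>span B. v - x \<in> W) \<and>
    (\<forall>c. (\<Sum>b\<in>B. scale (c b) b) \<in> W \<longrightarrow> (\<forall>b\<in>B. c b = 0))"
    (is "?L \<longleftrightarrow> ?R")
proof
  assume L: ?L
  then have fin: "finite B" and sub: "B \<subseteq> V"
    and ex1: "\<And>v. v \<in> V \<Longrightarrow>
      \<exists>!c. c \<in> B \<rightarrow>\<^sub>E UNIV \<and> coset W v = coset W (\<Sum>b\<in>B. scale (c b) b)"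
    by (auto simp: quotient_basis_def quotient_space_def)
  have gen: "\<exists>x\<in>span B. v - x \<in> W" if v: "v \<in> V" for v
  proof -
    obtain c where "coset W v = coset W (\<Sum>b\<in>B. scale (c b) b)"
      using ex1[OF v] by blast
    then have "v - (\<Sum>b\<in>B. scale (c b) b) \<in> W" by (simp add: coset_eq_iff[OF W])
    moreover have "(\<Sum>b\<in>B. scale (c b) b) \<in> span B"
      by (intro span_sum span_scale span_base)
    ultimately show ?thesis by blast
  qed
  have ind: "c b = 0" if c: "(\<Sum>b\<in>B. scale (c b) b) \<in> W" and b: "b \<in> B" for c b
  proof -
    \<comment> \<open>Both \<open>c\<close> and the zero coefficients represent the zero coset.\<close>
    have "restrict c B \<in> B \<rightarrow>\<^sub>E UNIV \<and>
        coset W 0 = coset W (\<Sum>b\<in>B. scale (restrict c B b) b)"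
      using subspace_neg[OF W c] by (simp add: coset_eq_iff[OF W])
    moreover have "restrict (\<lambda>_. 0) B \<in> B \<rightarrow>\<^sub>E UNIV \<and>
        coset W 0 = coset W (\<Sum>b\<in>B. scale (restrict (\<lambda>_. 0) B b) b)"
      using subspace_0[OF W] by (simp add: coset_eq_iff[OF W])
    ultimately have "restrict c B = restrict (\<lambda>_. 0) B"
      using ex1[OF subspace_0[OF V]] by blast
    then have "restrict c B b = restrict (\<lambda>_. 0) B b" by simp
    then show ?thesis using b by simp
  qed
  show ?R using fin sub gen ind by blast
next
  assume R: ?R
  then have fin: "finite B" and sub: "B \<subseteq> V"
    and gen: "\<And>v. v \<in> V \<Longrightarrow> \<exists>x\<in>span B. v - x \<in> W"
    and ind: "\<And>c b. (\<Sum>b\<in>B. scale (c b) b) \<in> W \<Longrightarrow> b \<in> B \<Longrightarrow> c b = 0"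
    by auto
  have "\<exists>!c. c \<in> B \<rightarrow>\<^sub>E UNIV \<and> coset W v = coset W (\<Sum>b\<in>B. scale (c b) b)"
    if v: "v \<in> V" for v
  proof (rule ex_ex1I)
    obtain x where x: "x \<in> span B" "v - x \<in> W" using gen[OF v] by blast
    obtain c where c: "x = (\<Sum>b\<in>B. scale (c b) b)"
      using x(1) span_finite[OF fin] by auto
    show "\<exists>c. c \<in> B \<rightarrow>\<^sub>E UNIV \<and> coset W v = coset W (\<Sum>b\<in>B. scale (c b) b)"
      using x(2) unfolding c
      by (intro exI[of _ "restrict c B"]) (simp add: coset_eq_iff[OF W])
  next
    fix c d
    assume c: "c \<in> B \<rightarrow>\<^sub>E UNIV \<and> coset W v = coset W (\<Sum>b\<in>B. scale (c b) b)"
      and d: "d \<in> B \<rightarrow>\<^sub>E UNIV \<and> coset W v = coset W (\<Sum>b\<in>B. scale (d b) b)"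
    then have "coset W (\<Sum>b\<in>B. scale (c b) b) = coset W (\<Sum>b\<in>B. scale (d b) b)" by simp
    then have "(\<Sum>b\<in>B. scale (c b) b) - (\<Sum>b\<in>B. scale (d b) b) \<in> W"
      by (simp only: coset_eq_iff[OF W])
    then have "(\<Sum>b\<in>B. scale (c b - d b) b) \<in> W"
      by (simp add: scale_left_diff_distrib sum_subtractf)
    from ind[OF this] have "\<And>b. b \<in> B \<Longrightarrow> c b = d b" by auto
    then show "c = d" using c d by (blast intro: PiE_ext)
  qed
  then show ?L using fin sub by (auto simp: quotient_basis_def quotient_space_def)
qed

text \<open>Each independent class has a representative in the span of the generating representatives,
  because representatives may be changed by elements of \<open>W\<close>. These new representatives are
  linearly independent, which reduces the claim to the exchange bound for spans.\<close>

lemma card_le_if_independent_mod: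
  assumes W: "subspace W" and fin: "finite B" "finite S"
    and ind: "\<And>c. (\<Sum>b\<in>B. scale (c b) b) \<in> W \<Longrightarrow> \<forall>b\<in>B. c b = 0"
    and gen: "\<And>b. b \<in> B \<Longrightarrow> \<exists>x\<in>span S. b - x \<in> W"
  shows "card B \<le> card S"
proof -
  obtain f where f: "\<And>b. b \<in> B \<Longrightarrow> f b \<in> span S \<and> b - f b \<in> W"
    using gen by metis
  have indf: "\<forall>b\<in>B. c b = 0" if "(\<Sum>b\<in>B. scale (c b) (f b)) = 0" for c
  proof (rule ind)
    have "(\<Sum>b\<in>B. scale (c b) (b - f b)) \<in> W"
      using f by (intro subspace_sum[OF W] subspace_scale[OF W]) auto
    then show "(\<Sum>b\<in>B. scale (c b) b) \<in> W"
      using that by (simp add: scale_right_diff_distrib sum_subtractf)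
  qed
  have inj: "inj_on f B"
  proof (rule inj_onI, rule ccontr)
    fix a b assume ab: "a \<in> B" "b \<in> B" "f a = f b" "a \<noteq> b"
    let ?c = "(\<lambda>_. 0)(a := 1, b := - 1) :: 'b \<Rightarrow> 'a"
    have "(\<Sum>x\<in>B. scale (?c x) (f x)) = (\<Sum>x\<in>{a, b}. scale (?c x) (f x))"
      using ab fin by (intro sum.mono_neutral_right) auto
    also have "\<dots> = 0" using ab by simp
    finally have "\<forall>x\<in>B. ?c x = 0" by (rule indf)
    then have "?c b = 0" using ab(2) by blast
    then show False by simp
  qed
  have "independent (f ` B)"
  proof (rule independent_if_scalars_zero)
    fix c x assume c: "(\<Sum>x\<in>f ` B. scale (c x) x) = 0" and x: "x \<in> f ` B"
    have "(\<Sum>b\<in>B. scale (c (f b)) (f b)) = 0"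
      using c by (simp add: sum.reindex[OF inj])
    from indf[OF this] show "c x = 0" using x by auto
  qed (use fin in simp)
  then have "card (f ` B) \<le> card S"
    using independent_span_bound[OF fin(2)] f by auto
  then show ?thesis by (simp add: card_image[OF inj])
qed

lemma quotient_dim_eq_card:
  assumes V: "subspace V" and W: "subspace W" and B: "quotient_basis scale V W B"
  shows "quotient_dim scale V W = card B"
proof -
  have le: "card B1 \<le> card B2"
    if B1: "quotient_basis scale V W B1" and B2: "quotient_basis scale V W B2" for B1 B2
  proof (rule card_le_if_independent_mod[OF W])
    note B1' = B1[unfolded quotient_basis_iff[OF V W]]
    note B2' = B2[unfolded quotient_basis_iff[OF V W]]
    show "finite B1" "finite B2" using B1' B2' by simp_all
    show "\<forall>b\<in>B1. c b = 0" if "(\<Sum>b\<in>B1. scale (c b) b) \<in> W" for c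
      using B1' that by simp
    show "\<exists>x\<in>span B2. b - x \<in> W" if "b \<in> B1" for b
    proof -
      have "b \<in> V" using B1' that by (auto simp only:)
      then show ?thesis using B2' by simp
    qed
  qed
  show ?thesis
    unfolding quotient_dim_def
  proof (rule the_equality)
    show "\<exists>B'. quotient_basis scale V W B' \<and> card B' = card B" using B by blast
    show "n = card B" if "\<exists>B'. quotient_basis scale V W B' \<and> card B' = n" for n
      using that le[OF _ B] le[OF B] by (metis antisym)
  qed
qed

lemma ex_quotient_basis_if_generated:
  assumes V: "subspace V" and W: "subspace W"
    and "finite S" "S \<subseteq> V" "\<forall>v\<in>V. \<exists>x\<in>span S. v - x \<in> W"
  shows "\<exists>B. quotient_basis scale V W B"
  using assms(3-)
proof (induction S rule: finite_psubset_induct)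
  case (psubset S)
  show ?case
  proof (cases "\<forall>c. (\<Sum>b\<in>S. scale (c b) b) \<in> W \<longrightarrow> (\<forall>b\<in>S. c b = 0)")
    case True
    then have "quotient_basis scale V W S"
      using psubset.hyps psubset.prems by (simp add: quotient_basis_iff[OF V W])
    then show ?thesis by blast
  next
    case False
    then obtain c a where c: "(\<Sum>b\<in>S. scale (c b) b) \<in> W" and a: "a \<in> S" "c a \<noteq> 0"
      by blast
    \<comment> \<open>Solving the relation for \<open>a\<close> shows that \<open>a\<close> can be dropped from the generators.\<close>
    define y where "y = - scale (inverse (c a)) (\<Sum>b\<in>S - {a}. scale (c b) b)"
    have y: "y \<in> span (S - {a})"
      unfolding y_def by (intro span_neg span_scale span_sum span_base)
    have "scale (inverse (c a)) (\<Sum>b\<in>S. scale (c b) b) = a - y"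
      using a by (simp add: y_def sum.remove[OF psubset.hyps] scale_right_distrib)
    then have ay: "a - y \<in> W" using subspace_scale[OF W c] by metis
    have "\<exists>x\<in>span (S - {a}). v - x \<in> W" if v: "v \<in> V" for v
    proof -
      obtain x where x: "x \<in> span S" "v - x \<in> W" using psubset.prems v by blast
      obtain t where t: "x - scale t a \<in> span (S - {a})"
        using span_breakdown[OF a(1) x(1)] by blast
      have "v - (x - scale t a + scale t y) = (v - x) + scale t (a - y)"
        by (simp add: scale_right_diff_distrib)
      then have "v - (x - scale t a + scale t y) \<in> W"
        using subspace_add[OF W x(2) subspace_scale[OF W ay, of t]] by (simp only:)
      moreover have "x - scale t a + scale t y \<in> span (S - {a})"
        by (intro span_add t span_scale y)
      ultimately show ?thesis by blast
    qed
    then have "\<forall>v\<in>V. \<exists>x\<in>span (S - {a}). v - x \<in> W" by (rule ballI)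
    moreover have "S - {a} \<subset> S" "S - {a} \<subseteq> V" using a psubset.prems(1) by auto
    ultimately show ?thesis by (intro psubset.IH)
  qed
qed

lemma quotient_dim_zero_eq_dim:
  assumes V: "subspace V" and B: "quotient_basis scale V {0} B"
  shows "quotient_dim scale V {0} = dim V"
proof -
  have fin: "finite B" and sub: "B \<subseteq> V" and gen: "V \<subseteq> span B"
    and ind: "\<And>c. (\<Sum>b\<in>B. scale (c b) b) = 0 \<Longrightarrow> \<forall>b\<in>B. c b = 0"
    using B unfolding quotient_basis_iff[OF V subspace_single_0] by auto
  have "independent B"
    using ind by (intro independent_if_scalars_zero[OF fin]) blast
  then have "dim V = card B"
    using sub gen by (intro dim_unique) auto
  then show ?thesis using quotient_dim_eq_card[OF V subspace_single_0 B] by simp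
qed

lemma ex_quotient_basis_zero:
  assumes V: "subspace V" and fd: "finite_dimensional scale V"
  shows "\<exists>B. quotient_basis scale V {0} B"
proof -
  obtain F where F: "finite F" "V \<subseteq> span F"
    using fd by (auto simp: finite_dimensional_def)
  obtain B where B: "B \<subseteq> V" "independent B" "V \<subseteq> span B"
    by (rule maximal_independent_subset[of V])
  have "B \<subseteq> span F" using B(1) F(2) by (rule subset_trans)
  then have "finite B" using independent_span_bound[OF F(1) B(2)] by simp
  then show ?thesis
  proof (rule ex_quotient_basis_if_generated[OF V subspace_single_0 _ B(1)])
    show "\<forall>v\<in>V. \<exists>x\<in>span B. v - x \<in> {0}" using B(3) by auto
  qed
qed

end


section \<open>Quotients of direct sums\<close>

definition direct_sum_set :: "nat \<Rightarrow> (nat \<Rightarrow> 'v::zero set) \<Rightarrow> (nat \<Rightarrow> 'v) set" where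
  "direct_sum_set m V = {u. (\<forall>k\<le>m. u k \<in> V k) \<and> (\<forall>k>m. u k = 0)}"

definition single :: "nat \<Rightarrow> 'v::zero \<Rightarrow> nat \<Rightarrow> 'v" where
  "single k v = (\<lambda>i. if i = k then v else 0)"

lemma single_same [simp]: "single k v k = v"
  by (simp add: single_def)

lemma single_other: "i \<noteq> k \<Longrightarrow> single k v i = 0"
  by (simp add: single_def)

lemma inj_single: "inj_on (single k) X"
  by (rule inj_onI) (metis single_same)

lemma sum_fun_apply: "(\<Sum>a\<in>X. f a) i = (\<Sum>a\<in>X. f a i)"
  for f :: "'a \<Rightarrow> nat \<Rightarrow> 'v::comm_monoid_add"
  by (induction X rule: infinite_finite_induct) (auto simp: zero_fun_def)

lemma vector_space_direct_sum_scale: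
  assumes "vector_space s"
  shows "vector_space (direct_sum_scale s)"
proof -
  interpret vector_space s by fact
  show ?thesis
    by unfold_locales
      (auto simp: direct_sum_scale_def fun_eq_iff scale_right_distrib scale_left_distrib)
qed

context vector_space
begin

lemma subspace_direct_sum_set:
  assumes "\<And>k. k \<le> m \<Longrightarrow> subspace (V k)"
  shows "module.subspace (direct_sum_scale scale) (direct_sum_set m V)"
proof -
  interpret D: vector_space "direct_sum_scale scale"
    by (rule vector_space_direct_sum_scale) unfold_locales
  show ?thesis
    using assms
    by (auto simp: D.subspace_def direct_sum_set_def direct_sum_scale_def
        intro: subspace_0 subspace_add subspace_scale)
qed

lemma single_in_direct_sum_set:
  assumes "\<And>k. k \<le> m \<Longrightarrow> subspace (V k)" "k \<le> m" "v \<in> V k"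
  shows "single k v \<in> direct_sum_set m V"
  using assms by (auto simp: direct_sum_set_def single_def subspace_0)

text \<open>The bases of the components, each placed in its own position, do not interact: the
  \<open>j\<close>-th entry of a linear combination only sees the basis of the \<open>j\<close>-th component. Hence
  generation and independence can be checked in each position separately.\<close>

lemma quotient_basis_direct_sum:
  assumes V: "\<And>k. k \<le> m \<Longrightarrow> subspace (V k)" and W: "\<And>k. k \<le> m \<Longrightarrow> subspace (W k)"
    and B: "\<And>k. k \<le> m \<Longrightarrow> quotient_basis scale (V k) (W k) (B k)"
  defines "D \<equiv> (\<Union>k\<le>m. single k ` B k)"
  shows "quotient_basis (direct_sum_scale scale) (direct_sum_set m V) (direct_sum_set m W) D"
    and "card D = (\<Sum>k\<le>m. card (B k))"
proof -
  interpret D: vector_space "direct_sum_scale scale"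
    by (rule vector_space_direct_sum_scale) unfold_locales
  have fin: "\<And>k. k \<le> m \<Longrightarrow> finite (B k)" and sub: "\<And>k. k \<le> m \<Longrightarrow> B k \<subseteq> V k"
    and gen: "\<And>k v. k \<le> m \<Longrightarrow> v \<in> V k \<Longrightarrow> \<exists>x\<in>span (B k). v - x \<in> W k"
    and ind: "\<And>k c b. k \<le> m \<Longrightarrow> (\<Sum>b\<in>B k. scale (c b) b) \<in> W k \<Longrightarrow> b \<in> B k \<Longrightarrow> c b = 0"
    using B by (auto simp: quotient_basis_iff[OF V W])
  have nonzero: "0 \<notin> B k" if k: "k \<le> m" for k
  proof
    assume "0 \<in> B k"
    moreover have "(\<Sum>b\<in>B k. scale ((if b = 0 then 1 else 0)) b) = 0"
      by (intro sum.neutral) auto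
    ultimately show False
      using ind[OF k, of "\<lambda>b. if b = 0 then 1 else 0" 0] subspace_0[OF W[OF k]] by simp
  qed
  have finD: "finite D" using fin by (auto simp: D_def)
  have entry: "(\<Sum>u\<in>D. direct_sum_scale scale (c u) u) j =
      (if j \<le> m then \<Sum>b\<in>B j. scale (c (single j b)) b else 0)" for c j
  proof -
    have "(\<Sum>u\<in>D. direct_sum_scale scale (c u) u) j = (\<Sum>u\<in>D. scale (c u) (u j))"
      by (simp add: sum_fun_apply direct_sum_scale_def)
    also have "\<dots> = (if j \<le> m then \<Sum>b\<in>B j. scale (c (single j b)) b else 0)"
    proof (cases "j \<le> m")
      case True
      have "(\<Sum>u\<in>D. scale (c u) (u j)) = (\<Sum>u\<in>single j ` B j. scale (c u) (u j))"
      proof (rule sum.mono_neutral_right[OF finD])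
        show "single j ` B j \<subseteq> D" using True by (auto simp: D_def)
        show "\<forall>u\<in>D - single j ` B j. scale (c u) (u j) = 0"
        proof
          fix u assume u: "u \<in> D - single j ` B j"
          then obtain k b where "b \<in> B k" "u = single k b" by (auto simp: D_def)
          with u have "u j = 0" by (cases "k = j") (auto simp: single_other)
          then show "scale (c u) (u j) = 0" by simp
        qed
      qed
      then show ?thesis using True by (simp add: sum.reindex[OF inj_single])
    next
      case False
      then show ?thesis by (auto simp: D_def single_def intro!: sum.neutral)
    qed
    finally show ?thesis .
  qed
  have "\<exists>x\<in>D.span D. v - x \<in> direct_sum_set m W" if v: "v \<in> direct_sum_set m V" for v
  proof -
    have "\<exists>c. v k - (\<Sum>b\<in>B k. scale (c b) b) \<in> W k" if k: "k \<le> m" for k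
    proof -
      have "v k \<in> V k" using v k by (auto simp: direct_sum_set_def)
      then obtain x where x: "x \<in> span (B k)" "v k - x \<in> W k" using gen[OF k] by blast
      then show ?thesis using span_finite[OF fin[OF k]] by auto
    qed
    then obtain c where c: "\<And>k. k \<le> m \<Longrightarrow> v k - (\<Sum>b\<in>B k. scale (c k b) b) \<in> W k"
      by metis
    \<comment> \<open>A sequence in \<open>D\<close> has exactly one nonzero entry and so determines the component
      that it comes from; \<open>e\<close> collects the coefficients of all components.\<close>
    define e where "e u = (let k = (THE k. u k \<noteq> 0) in c k (u k))" for u
    have e: "e (single k b) = c k b" if "k \<le> m" "b \<in> B k" for k b
    proof -
      have "b \<noteq> 0" using nonzero that by blast
      then have "(THE i. single k b i \<noteq> 0) = k"
        by (intro the_equality) (auto simp: single_def split: if_splits)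
      then show ?thesis by (simp add: e_def)
    qed
    let ?x = "\<Sum>u\<in>D. direct_sum_scale scale (e u) u"
    have "v - ?x \<in> direct_sum_set m W"
      using v c by (auto simp: direct_sum_set_def entry e cong: sum.cong)
    moreover have "?x \<in> D.span D" by (intro D.span_sum D.span_scale D.span_base)
    ultimately show ?thesis by blast
  qed
  moreover have "c u = 0"
    if c: "(\<Sum>u\<in>D. direct_sum_scale scale (c u) u) \<in> direct_sum_set m W" and u: "u \<in> D"
    for c u
  proof -
    obtain k b where k: "k \<le> m" and b: "b \<in> B k" and u: "u = single k b"
      using u by (auto simp: D_def)
    have "(\<Sum>b\<in>B k. scale (c (single k b)) b) \<in> W k"
      using c k entry[of c k] by (auto simp: direct_sum_set_def)
    from ind[OF k this b] show ?thesis by (simp add: u)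
  qed
  moreover have "D \<subseteq> direct_sum_set m V"
    using sub by (auto simp: D_def intro!: single_in_direct_sum_set V)
  ultimately show "quotient_basis (direct_sum_scale scale)
      (direct_sum_set m V) (direct_sum_set m W) D"
    using finD
    by (subst D.quotient_basis_iff[OF subspace_direct_sum_set subspace_direct_sum_set])
      (auto simp: V W)
  have "single i ` B i \<inter> single j ` B j = {}" if "i \<le> m" "j \<le> m" "i \<noteq> j" for i j
  proof -
    have "single i a \<noteq> single j b" if "a \<in> B i" for a b
    proof
      assume "single i a = single j b"
      then have "single i a i = single j b i" by simp
      then show False using \<open>i \<noteq> j\<close> nonzero[OF \<open>i \<le> m\<close>] that by (auto simp: single_other)
    qed
    then show ?thesis by blast
  qed
  then have "card D = (\<Sum>k\<le>m. card (single k ` B k))"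
    unfolding D_def using fin by (intro card_UN_disjoint) auto
  then show "card D = (\<Sum>k\<le>m. card (B k))" by (simp add: card_image[OF inj_single])
qed

text \<open>The \<open>k\<close>-th entries of a finite system that generates the whole quotient generate the
  \<open>k\<close>-th quotient.\<close>

lemma ex_quotient_basis_component:
  assumes V: "\<And>k. k \<le> m \<Longrightarrow> subspace (V k)" and W: "\<And>k. k \<le> m \<Longrightarrow> subspace (W k)"
    and B: "quotient_basis (direct_sum_scale scale) (direct_sum_set m V) (direct_sum_set m W) B"
    and k: "k \<le> m"
  shows "\<exists>B. quotient_basis scale (V k) (W k) B"
proof -
  interpret D: vector_space "direct_sum_scale scale"
    by (rule vector_space_direct_sum_scale) unfold_locales
  have fin: "finite B" and sub: "B \<subseteq> direct_sum_set m V"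
    and gen: "\<And>v. v \<in> direct_sum_set m V \<Longrightarrow> \<exists>x\<in>D.span B. v - x \<in> direct_sum_set m W"
    using B by (auto simp: D.quotient_basis_iff[OF subspace_direct_sum_set[OF V]
          subspace_direct_sum_set[OF W]])
  show ?thesis
  proof (rule ex_quotient_basis_if_generated[OF V[OF k] W[OF k]])
    show "finite ((\<lambda>u. u k) ` B)" using fin by simp
    show "(\<lambda>u. u k) ` B \<subseteq> V k" using sub k by (auto simp: direct_sum_set_def)
    show "\<forall>v\<in>V k. \<exists>x\<in>span ((\<lambda>u. u k) ` B). v - x \<in> W k"
    proof
      fix v assume "v \<in> V k"
      then obtain x where x: "x \<in> D.span B" "single k v - x \<in> direct_sum_set m W"
        using gen[OF single_in_direct_sum_set[OF V k]] by blast
      obtain c where "x = (\<Sum>u\<in>B. direct_sum_scale scale (c u) u)"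
        using x(1) D.span_finite[OF fin] by auto
      then have "x k = (\<Sum>u\<in>B. scale (c u) (u k))"
        by (simp add: sum_fun_apply direct_sum_scale_def)
      moreover have "\<dots> \<in> span ((\<lambda>u. u k) ` B)"
        by (intro span_sum span_scale span_base) auto
      moreover have "(single k v - x) k \<in> W k"
        using x(2) k by (auto simp: direct_sum_set_def)
      then have "v - x k \<in> W k" by simp
      ultimately show "\<exists>x\<in>span ((\<lambda>u. u k) ` B). v - x \<in> W k" by metis
    qed
  qed
qed

lemma quotient_dim_direct_sum:
  assumes V: "\<And>k. k \<le> m \<Longrightarrow> subspace (V k)" and W: "\<And>k. k \<le> m \<Longrightarrow> subspace (W k)"
    and ex: "\<exists>B. quotient_basis (direct_sum_scale scale)
      (direct_sum_set m V) (direct_sum_set m W) B"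
  shows "quotient_dim (direct_sum_scale scale) (direct_sum_set m V) (direct_sum_set m W) =
    (\<Sum>k\<le>m. quotient_dim scale (V k) (W k))"
proof -
  interpret D: vector_space "direct_sum_scale scale"
    by (rule vector_space_direct_sum_scale) unfold_locales
  obtain B0 where B0: "quotient_basis (direct_sum_scale scale)
      (direct_sum_set m V) (direct_sum_set m W) B0"
    using ex by blast
  have "\<exists>B. quotient_basis scale (V k) (W k) B" if "k \<le> m" for k
    by (rule ex_quotient_basis_component[OF V W B0 that])
  then obtain B where B: "\<And>k. k \<le> m \<Longrightarrow> quotient_basis scale (V k) (W k) (B k)"
    by metis
  note basis = quotient_basis_direct_sum[OF V W B]
  have "quotient_dim (direct_sum_scale scale) (direct_sum_set m V) (direct_sum_set m W) =
      (\<Sum>k\<le>m. card (B k))"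
    using D.quotient_dim_eq_card[OF subspace_direct_sum_set subspace_direct_sum_set basis(1)]
      basis(2) V W by simp
  also have "\<dots> = (\<Sum>k\<le>m. quotient_dim scale (V k) (W k))"
    using quotient_dim_eq_card[OF V W B] by (intro sum.cong) auto
  finally show ?thesis .
qed

lemma dim_direct_sum:
  assumes V: "\<And>k. k \<le> m \<Longrightarrow> subspace (V k)"
    and fd: "finite_dimensional (direct_sum_scale scale) (direct_sum_set m V)"
  shows "vector_space.dim (direct_sum_scale scale) (direct_sum_set m V) = (\<Sum>k\<le>m. dim (V k))"
proof -
  interpret D: vector_space "direct_sum_scale scale"
    by (rule vector_space_direct_sum_scale) unfold_locales
  have zero: "{0} = direct_sum_set m (\<lambda>_. {0 :: 'b})"
    by (auto simp: direct_sum_set_def fun_eq_iff) (metis not_le)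
  note sub = subspace_direct_sum_set[OF V]
  obtain B where B: "quotient_basis (direct_sum_scale scale) (direct_sum_set m V) {0} B"
    using D.ex_quotient_basis_zero[OF sub fd] by blast
  have comp: "quotient_dim scale (V k) {0} = dim (V k)" if "k \<le> m" for k
    using ex_quotient_basis_component[OF V _ B[unfolded zero] that]
      quotient_dim_zero_eq_dim[OF V[OF that]] by (auto simp: subspace_single_0)
  have "D.dim (direct_sum_set m V) =
      quotient_dim (direct_sum_scale scale) (direct_sum_set m V) {0}"
    using D.quotient_dim_zero_eq_dim[OF sub B] by simp
  also have "\<dots> = (\<Sum>k\<le>m. quotient_dim scale (V k) {0})"
    unfolding zero by (rule quotient_dim_direct_sum[OF V])
      (use B in \<open>auto simp: zero subspace_single_0\<close>)
  also have "\<dots> = (\<Sum>k\<le>m. dim (V k))"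
    using comp by (intro sum.cong) auto
  finally show ?thesis .
qed

end


section \<open>Diagonal operators\<close>

lemma pts_direct_sum: "pts (direct_sum m H) = direct_sum_set m (\<lambda>k. pts (H k))"
  by (simp add: direct_sum_def direct_sum_set_def)

lemma ker_direct_sum_operator:
  "ker_on (direct_sum m H) (direct_sum_operator m Ak) =
    direct_sum_set m (\<lambda>k. ker_on (H k) (Ak k))"
  by (auto simp: ker_on_def pts_direct_sum direct_sum_set_def direct_sum_operator_def fun_eq_iff)

lemma image_direct_sum_operator:
  "direct_sum_operator m Ak ` direct_sum_set m V = direct_sum_set m (\<lambda>k. Ak k ` V k)"
proof
  show "direct_sum_set m (\<lambda>k. Ak k ` V k) \<subseteq> direct_sum_operator m Ak ` direct_sum_set m V"
  proof
    fix w assume w: "w \<in> direct_sum_set m (\<lambda>k. Ak k ` V k)"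
    then have "\<forall>k. \<exists>v. k \<le> m \<longrightarrow> v \<in> V k \<and> w k = Ak k v"
      by (auto simp: direct_sum_set_def)
    then obtain u where u: "\<And>k. k \<le> m \<Longrightarrow> u k \<in> V k \<and> w k = Ak k (u k)"
      by metis
    let ?u = "\<lambda>k. if k \<le> m then u k else 0"
    have "?u \<in> direct_sum_set m V" using u by (auto simp: direct_sum_set_def)
    moreover have "w = direct_sum_operator m Ak ?u"
    proof
      show "w k = direct_sum_operator m Ak ?u k" for k
        using u[of k] w by (simp add: direct_sum_operator_def direct_sum_set_def)
    qed
    ultimately show "w \<in> direct_sum_operator m Ak ` direct_sum_set m V" by blast
  qed
qed (auto simp: direct_sum_set_def direct_sum_operator_def)

context vector_space
begin

lemma bounded_operator_zero:
  assumes H: "subspace (pts H)" and A: "bounded_operator scale H H' A"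
  shows "A 0 = 0"
proof -
  have "A (0 + 0) = A 0 + A 0"
    using A subspace_0[OF H] unfolding bounded_operator_def by blast
  then show ?thesis by simp
qed

lemma subspace_ker_on:
  assumes H: "subspace (pts H)" and A: "bounded_operator scale H H' A"
  shows "subspace (ker_on H A)"
  using A H bounded_operator_zero[OF H A]
  by (auto simp: subspace_def ker_on_def bounded_operator_def)

lemma subspace_image_bounded_operator:
  assumes H: "subspace (pts H)" and A: "bounded_operator scale H H' A"
  shows "subspace (A ` pts H)"
proof (rule subspaceI)
  show "0 \<in> A ` pts H"
    using bounded_operator_zero[OF H A] subspace_0[OF H] by (metis imageI)
  show "x + y \<in> A ` pts H" if xy: "x \<in> A ` pts H" "y \<in> A ` pts H" for x y
  proof -
    obtain u v where "u \<in> pts H" "v \<in> pts H" "x = A u" "y = A v" using xy by blast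
    moreover from this have "x + y = A (u + v)" using A by (simp add: bounded_operator_def)
    ultimately show ?thesis using subspace_add[OF H] by blast
  qed
  show "scale c x \<in> A ` pts H" if x: "x \<in> A ` pts H" for c x
  proof -
    obtain u where "u \<in> pts H" "x = A u" using x by blast
    moreover from this have "scale c x = A (scale c u)" using A by (simp add: bounded_operator_def)
    ultimately show ?thesis using subspace_scale[OF H] by blast
  qed
qed

text \<open>Kernel and image of a diagonal operator are formed entry by entry, so both terms of the
  index are additive.\<close>

theorem fredholm_index_direct_sum:
  assumes H1: "\<And>k. k \<le> m \<Longrightarrow> subspace (pts (H1 k))"
    and H2: "\<And>k. k \<le> m \<Longrightarrow> subspace (pts (H2 k))"
    and Ak: "\<And>k. k \<le> m \<Longrightarrow> bounded_operator scale (H1 k) (H2 k) (Ak k)"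
    and fred: "fredholm (direct_sum_scale scale) (direct_sum m H1) (direct_sum m H2)
      (direct_sum_operator m Ak)"
  shows "fredholm_index (direct_sum_scale scale) (direct_sum m H1) (direct_sum m H2)
      (direct_sum_operator m Ak) = (\<Sum>k\<le>m. fredholm_index scale (H1 k) (H2 k) (Ak k))"
proof -
  have "vector_space.dim (direct_sum_scale scale)
      (direct_sum_set m (\<lambda>k. ker_on (H1 k) (Ak k))) = (\<Sum>k\<le>m. dim (ker_on (H1 k) (Ak k)))"
    using fred by (intro dim_direct_sum subspace_ker_on[OF H1 Ak])
      (auto simp: fredholm_def ker_direct_sum_operator)
  moreover have "quotient_dim (direct_sum_scale scale) (direct_sum_set m (\<lambda>k. pts (H2 k)))
      (direct_sum_set m (\<lambda>k. Ak k ` pts (H1 k))) =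
      (\<Sum>k\<le>m. quotient_dim scale (pts (H2 k)) (Ak k ` pts (H1 k)))"
    using fred by (intro quotient_dim_direct_sum H2 subspace_image_bounded_operator[OF H1 Ak])
      (auto simp: fredholm_def pts_direct_sum image_direct_sum_operator)
  ultimately show ?thesis
    by (simp add: fredholm_index_def ker_direct_sum_operator pts_direct_sum
        image_direct_sum_operator sum_subtractf)
qed

end

theorem theorem2:
  fixes M :: "'x::metric_space set"
    and \<A> :: "('x, 'e::euclidean_space) chart set"
    and m :: nat
    and Ms :: "nat \<Rightarrow> 'x set"
    and s :: "'k::{real_normed_field,banach} \<Rightarrow> 'v::ab_group_add \<Rightarrow> 'v"
    and emb :: "('x \<Rightarrow> 'k) \<Rightarrow> 'v"
    and mul :: "('x \<Rightarrow> 'k) \<Rightarrow> 'v \<Rightarrow> 'v"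
    and H1 H2 :: "nat \<Rightarrow> 'v normed_space"
    and T :: "nat \<Rightarrow> ('v \<Rightarrow> 'v) set"
    and A :: "'x \<Rightarrow> 'v \<Rightarrow> 'v"
    and Ak :: "nat \<Rightarrow> 'v \<Rightarrow> 'v"
    and Agen :: "(nat \<Rightarrow> 'v) \<Rightarrow> nat \<Rightarrow> 'v"
  assumes "compact M"
    and "stratified_manifold M \<A> m Ms"
    and "generalized_functions s M \<A> emb mul"
    and "\<forall>k\<le>m. banach_function_space s M \<A> emb mul (H1 k)"
    and "\<forall>k\<le>m. banach_function_space s M \<A> emb mul (H2 k)"
    and "operator_family s m Ms H1 H2 T A"
    and "\<forall>k\<le>m. \<forall>x\<in>stratum Ms k.
           local_operator s M \<A> mul (H1 k) (H2 k) (A x) \<and> fredholm s (H1 k) (H2 k) (A x)"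
    and "\<forall>k\<le>m. continuous_family_on_closure s (H1 k) (H2 k) (stratum Ms k) A"
    and "generated_components s M \<A> mul m Ms H1 H2 A Ak"
    and "Agen = direct_sum_operator m Ak"
    and "fredholm (direct_sum_scale s) (direct_sum m H1) (direct_sum m H2) Agen"
  shows "fredholm_index (direct_sum_scale s) (direct_sum m H1) (direct_sum m H2) Agen =
         (\<Sum>k=0..m. fredholm_index s (H1 k) (H2 k) (Ak k))"
proof -
  interpret generalized_functions s M \<A> emb mul by fact
  have "\<And>k. k \<le> m \<Longrightarrow> subspace (pts (H1 k))" "\<And>k. k \<le> m \<Longrightarrow> subspace (pts (H2 k))"
    using assms(4,5) by (simp_all add: banach_function_space_def banach_space_def)
  moreover have "\<And>k. k \<le> m \<Longrightarrow> bounded_operator s (H1 k) (H2 k) (Ak k)"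
    using assms(9) unfolding generated_components_def by blast
  ultimately have "fredholm_index (direct_sum_scale s) (direct_sum m H1) (direct_sum m H2)
      (direct_sum_operator m Ak) = (\<Sum>k\<le>m. fredholm_index s (H1 k) (H2 k) (Ak k))"
    using assms(10,11) by (intro fredholm_index_direct_sum) simp_all
  then show ?thesis by (simp add: assms(10) atMost_atLeast0)
qed

end
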